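(* Let $\mathcal{H}$ be a separable Hilbert space and let $\mathcal{S}, \mathcal{W} \subset \mathcal{H}$ be closed subspaces such that $\mathcal{W} \cap \mathcal{S}^{\perp} = \{0\}$. Suppose that $\{s_k\}_{k \in \mathbb{N}}$ and $\{w_k\}_{k \in \mathbb{N}}$ are Riesz bases for $\mathcal{S}$ and $\mathcal{W}$ respectively, with constants $A,B,C,D>0$, i.e. for all $\{\alpha_k\}_{k\in\mathbb{N}} \in l^2(\mathbb{N})$, $$A \sum_{k}|\alpha_k|^2 \leq \Big\| \sum_{k} \alpha_k w_k \Big\|^2 \leq B \sum_{k}|\alpha_k|^2, \qquad C \sum_{k}|\alpha_k|^2 \leq \Big\| \sum_{k} \alpha_k s_k \Big\|^2 \leq D \sum_{k}|\alpha_k|^2 .$$ Let $U = (u_{ij})_{i,j\in\mathbb{N}}$, $u_{ij} = \langle s_i, w_j\rangle$, be regarded as an operator on $l^2(\mathbb{N})$. Suppose that $$f = \sum_{k\in\mathbb{N}} \beta_k w_k, \qquad \beta = \{\beta_1,\beta_2,\ldots\} \in l^2(\mathbb{N}).$$ Let $n \in \mathbb{N}$. Then there is an $M \in \mathbb{N}$ (in particular, $M = \min\{k \in \mathbb{N} : 0 \notin \sigma(P_nU^*P_kUP_n|_{P_n l^2(\mathbb{N})})\}$) such that, for all $m \geq M$, the linear system $$\left(P_nU^*P_mUP_n|_{P_n l^2(\mathbb{N})}\right)\begin{pmatrix}\tilde\beta_1\\ \vdots\\ \tilde\beta_n\end{pmatrix} = P_nU^*P_m\begin{pmatrix}\langle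 s_1,f\rangle\\ \vdots\\ \langle s_m,f\rangle\end{pmatrix}$$ has a unique solution $\{\tilde\beta_1,\ldots,\tilde\beta_n\}$. Also, if $\tilde f = \sum_{k=1}^n \tilde\beta_k w_k$, then $$\|f-\tilde f\|_{\mathcal{H}} \leq \sqrt{B}\,(1+K_{n,m})\,\|P_n^{\perp}\beta\|_{l^2(\mathbb{N})},$$ where $$K_{n,m} = \left\|\left(P_nU^*P_mUP_n|_{P_n l^2(\mathbb{N})}\right)^{-1}P_nU^*P_mUP_n^{\perp}\right\|.$$
   Context: $\{e_j\}_{j\in\mathbb{N}}$ is the natural (standard) basis of $l^2(\mathbb{N})$. For $n\in\mathbb{N}$, $P_n$ is the orthogonal projection of $l^2(\mathbb{N})$ onto $\mathrm{span}\{e_1,\ldots,e_n\}$ and $P_n^{\perp} = I - P_n$. Vectors in $\mathbb{C}^m$ are identified with elements of $P_m l^2(\mathbb{N})$. $\sigma(T)$ denotes the spectrum of an operator $T$, and $\|\cdot\|$ of an operator is the operator norm. The inner product $\langle\cdot,\cdot\rangle$ is taken linear in the second argument, so that $\langle s_i,f\rangle = \sum_j u_{ij}\beta_j$. *)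

theory Defs
  imports "HOL-Analysis.Analysis"
begin

class complex_vector = real_vector +
  fixes scaleC :: "complex \<Rightarrow> 'a \<Rightarrow> 'a"  (infixr "*\<^sub>C" 75)
  assumes scaleC_add_right: "a *\<^sub>C (x + y) = a *\<^sub>C x + a *\<^sub>C y"
    and scaleC_add_left: "(a + b) *\<^sub>C x = a *\<^sub>C x + b *\<^sub>C x"
    and scaleC_scaleC: "a *\<^sub>C b *\<^sub>C x = (a * b) *\<^sub>C x"
    and scaleC_one: "1 *\<^sub>C x = x"
    and scaleR_scaleC: "r *\<^sub>R x = complex_of_real r *\<^sub>C x"

global_interpretation complex_vector: vector_space "scaleC :: complex \<Rightarrow> 'a \<Rightarrow> 'a::complex_vector"
  defines csubspace = complex_vector.subspace
    and cspan = complex_vector.span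
  by unfold_locales (rule scaleC_add_right scaleC_add_left scaleC_scaleC scaleC_one)+

text \<open>The inner product is linear in the second and conjugate-linear in the first argument.\<close>

class complex_inner = complex_vector + real_normed_vector +
  fixes cinner :: "'a \<Rightarrow> 'a \<Rightarrow> complex"
  assumes cinner_commute: "cinner x y = cnj (cinner y x)"
    and cinner_add_right: "cinner x (y + z) = cinner x y + cinner x z"
    and cinner_scaleC_right: "cinner x (a *\<^sub>C y) = a * cinner x y"
    and cinner_same: "cinner x x = complex_of_real ((norm x)\<^sup>2)"

class chilbert_space = complex_inner + complete_space

instance chilbert_space \<subseteq> banach ..

definition orth_compl :: "'a::complex_inner set \<Rightarrow> 'a set" where
  "orth_compl S = {x. \<forall>y\<in>S. cinner y x = 0}"

definition orth_proj :: "'a::complex_inner set \<Rightarrow> 'a \<Rightarrow> 'a" where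
  "orth_proj V x = (THE y. y \<in> V \<and> x - y \<in> orth_compl V)"

definition cadjoint :: "('a::complex_inner \<Rightarrow> 'b::complex_inner) \<Rightarrow> 'b \<Rightarrow> 'a" where
  "cadjoint T = (SOME T'. \<forall>x y. cinner (T x) y = cinner x (T' y))"

text \<open>A bounded operator on the subspace \<open>V\<close> is represented by any function on the whole
  space that restricts to it; values outside \<open>V\<close> are ignored.\<close>

definition bounded_op_on :: "'a::complex_inner set \<Rightarrow> ('a \<Rightarrow> 'a) \<Rightarrow> bool" where
  "bounded_op_on V T \<longleftrightarrow> T ` V \<subseteq> V
     \<and> (\<forall>x\<in>V. \<forall>y\<in>V. T (x + y) = T x + T y)
     \<and> (\<forall>a. \<forall>x\<in>V. T (a *\<^sub>C x) = a *\<^sub>C T x)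
     \<and> (\<exists>K. \<forall>x\<in>V. norm (T x) \<le> K * norm x)"

definition spectrum_on :: "'a::complex_inner set \<Rightarrow> ('a \<Rightarrow> 'a) \<Rightarrow> complex set" where
  "spectrum_on V T = {z. \<not> (\<exists>R. bounded_op_on V R
     \<and> (\<forall>x\<in>V. R (T x - z *\<^sub>C x) = x \<and> T (R x) - z *\<^sub>C R x = x))}"

typedef l2 = "{x :: nat \<Rightarrow> complex. summable (\<lambda>k. (cmod (x k))\<^sup>2)}"
  morphisms coord Abs_l2
  by (rule exI[of _ "\<lambda>_. 0"]) simp

setup_lifting type_definition_l2

lemma summable_coord: "summable (\<lambda>k. (cmod (coord x k))\<^sup>2)"
  using coord by blast

lemma square_summable_add:
  assumes "summable (\<lambda>k. (cmod (x k))\<^sup>2)" "summable (\<lambda>k. (cmod (y k))\<^sup>2)"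
  shows "summable (\<lambda>k. (cmod (x k + y k))\<^sup>2)"
proof (rule summable_comparison_test')
  show "summable (\<lambda>k. 2 * (cmod (x k))\<^sup>2 + 2 * (cmod (y k))\<^sup>2)"
    using assms by (intro summable_add summable_mult)
next
  fix k
  have "(cmod (x k + y k))\<^sup>2 \<le> (cmod (x k) + cmod (y k))\<^sup>2"
    by (intro power_mono norm_triangle_ineq) simp
  also have "\<dots> \<le> 2 * (cmod (x k))\<^sup>2 + 2 * (cmod (y k))\<^sup>2"
    using sum_squares_bound[of "cmod (x k)" "cmod (y k)"] by (simp add: power2_sum)
  finally show "norm ((cmod (x k + y k))\<^sup>2) \<le> 2 * (cmod (x k))\<^sup>2 + 2 * (cmod (y k))\<^sup>2"
    by simp
qed

lemma summable_cnj_mult: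
  assumes "summable (\<lambda>k. (cmod (x k))\<^sup>2)" "summable (\<lambda>k. (cmod (y k))\<^sup>2)"
  shows "summable (\<lambda>k. cnj (x k) * y k)"
proof (rule summable_comparison_test')
  show "summable (\<lambda>k. (cmod (x k))\<^sup>2 + (cmod (y k))\<^sup>2)"
    using assms by (intro summable_add)
next
  fix k
  have "2 * (cmod (x k) * cmod (y k)) \<le> (cmod (x k))\<^sup>2 + (cmod (y k))\<^sup>2"
    using sum_squares_bound[of "cmod (x k)" "cmod (y k)"] by simp
  moreover have "0 \<le> cmod (x k) * cmod (y k)" by simp
  ultimately have "cmod (x k) * cmod (y k) \<le> (cmod (x k))\<^sup>2 + (cmod (y k))\<^sup>2"
    by linarith
  then show "norm (cnj (x k) * y k) \<le> (cmod (x k))\<^sup>2 + (cmod (y k))\<^sup>2"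
    by (simp add: norm_mult)
qed

instantiation l2 :: complex_inner
begin

lift_definition zero_l2 :: l2 is "\<lambda>_. 0" by simp
lift_definition plus_l2 :: "l2 \<Rightarrow> l2 \<Rightarrow> l2" is "\<lambda>x y k. x k + y k"
  by (rule square_summable_add)
lift_definition scaleC_l2 :: "complex \<Rightarrow> l2 \<Rightarrow> l2" is "\<lambda>a x k. a * x k"
  by (simp add: norm_mult power_mult_distrib summable_mult)
lift_definition uminus_l2 :: "l2 \<Rightarrow> l2" is "\<lambda>x k. - x k" by simp
lift_definition cinner_l2 :: "l2 \<Rightarrow> l2 \<Rightarrow> complex" is "\<lambda>x y. \<Sum>k. cnj (x k) * y k" .
lift_definition norm_l2 :: "l2 \<Rightarrow> real" is "\<lambda>x. sqrt (\<Sum>k. (cmod (x k))\<^sup>2)" .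
definition minus_l2 :: "l2 \<Rightarrow> l2 \<Rightarrow> l2" where "x - y = x + (- y)" for x y :: l2
definition scaleR_l2 :: "real \<Rightarrow> l2 \<Rightarrow> l2" where "r *\<^sub>R x = complex_of_real r *\<^sub>C x" for x :: l2
definition dist_l2 :: "l2 \<Rightarrow> l2 \<Rightarrow> real" where "dist x y = norm (x - y)" for x y :: l2
definition sgn_l2 :: "l2 \<Rightarrow> l2" where "sgn x = inverse (norm x) *\<^sub>R x" for x :: l2
definition uniformity_l2 :: "(l2 \<times> l2) filter"
  where "uniformity_l2 = (INF e\<in>{0<..}. principal {(x, y). dist x y < e})"
definition open_l2 :: "l2 set \<Rightarrow> bool"
  where "open_l2 U \<longleftrightarrow> (\<forall>x\<in>U. eventually (\<lambda>(x', y). x' = x \<longrightarrow> y \<in> U) uniformity)"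

instance
proof
  fix a b :: complex and r s :: real and x y z :: l2
  show "x + y + z = x + (y + z)" by transfer (simp add: add.assoc)
  show "x + y = y + x" by transfer (simp add: add.commute)
  show "0 + x = x" by transfer simp
  show "- x + x = 0" by transfer simp
  show "x - y = x + - y" by (rule minus_l2_def)
  show "r *\<^sub>R (x + y) = r *\<^sub>R x + r *\<^sub>R y"
    unfolding scaleR_l2_def by transfer (simp add: algebra_simps)
  show "(r + s) *\<^sub>R x = r *\<^sub>R x + s *\<^sub>R x"
    unfolding scaleR_l2_def by transfer (simp add: algebra_simps)
  show "r *\<^sub>R s *\<^sub>R x = (r * s) *\<^sub>R x"
    unfolding scaleR_l2_def by transfer (simp add: algebra_simps)
  show "1 *\<^sub>R x = x" unfolding scaleR_l2_def by transfer simp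
  show "a *\<^sub>C (x + y) = a *\<^sub>C x + a *\<^sub>C y" by transfer (simp add: algebra_simps)
  show "(a + b) *\<^sub>C x = a *\<^sub>C x + b *\<^sub>C x" by transfer (simp add: algebra_simps)
  show "a *\<^sub>C b *\<^sub>C x = (a * b) *\<^sub>C x" by transfer (simp add: algebra_simps)
  show "1 *\<^sub>C x = x" by transfer simp
  show "r *\<^sub>R x = complex_of_real r *\<^sub>C x" by (rule scaleR_l2_def)
  show "dist x y = norm (x - y)" by (rule dist_l2_def)
  show "sgn x = inverse (norm x) *\<^sub>R x" by (rule sgn_l2_def)
  show "uniformity = (INF e\<in>{0<..}. principal {(x :: l2, y). dist x y < e})"
    by (rule uniformity_l2_def)
  show "open U \<longleftrightarrow> (\<forall>x\<in>U. eventually (\<lambda>(x', y). x' = x \<longrightarrow> y \<in> U) uniformity)" for U :: "l2 set"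
    by (rule open_l2_def)
  show "norm x = 0 \<longleftrightarrow> x = 0"
    by transfer (auto simp: suminf_eq_zero_iff)
  show "norm (x + y) \<le> norm x + norm y"
  proof transfer
    fix x y :: "nat \<Rightarrow> complex"
    assume x: "summable (\<lambda>k. (cmod (x k))\<^sup>2)" and y: "summable (\<lambda>k. (cmod (y k))\<^sup>2)"
    show "sqrt (\<Sum>k. (cmod (x k + y k))\<^sup>2) \<le> sqrt (\<Sum>k. (cmod (x k))\<^sup>2) + sqrt (\<Sum>k. (cmod (y k))\<^sup>2)"
    proof (rule LIMSEQ_le)
      show "(\<lambda>n. sqrt (\<Sum>k<n. (cmod (x k + y k))\<^sup>2)) \<longlonglongrightarrow> sqrt (\<Sum>k. (cmod (x k + y k))\<^sup>2)"
        by (intro tendsto_intros summable_LIMSEQ square_summable_add x y)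
      show "(\<lambda>n. sqrt (\<Sum>k<n. (cmod (x k))\<^sup>2) + sqrt (\<Sum>k<n. (cmod (y k))\<^sup>2))
          \<longlonglongrightarrow> sqrt (\<Sum>k. (cmod (x k))\<^sup>2) + sqrt (\<Sum>k. (cmod (y k))\<^sup>2)"
        by (intro tendsto_intros summable_LIMSEQ x y)
      have "sqrt (\<Sum>k<n. (cmod (x k + y k))\<^sup>2)
          \<le> sqrt (\<Sum>k<n. (cmod (x k))\<^sup>2) + sqrt (\<Sum>k<n. (cmod (y k))\<^sup>2)" for n
      proof -
        have "sqrt (\<Sum>k<n. (cmod (x k + y k))\<^sup>2) \<le> sqrt (\<Sum>k<n. (cmod (x k) + cmod (y k))\<^sup>2)"
          by (intro real_sqrt_le_mono sum_mono power_mono norm_triangle_ineq) simp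
        also have "\<dots> \<le> sqrt (\<Sum>k<n. (cmod (x k))\<^sup>2) + sqrt (\<Sum>k<n. (cmod (y k))\<^sup>2)"
          using L2_set_triangle_ineq[of "\<lambda>k. cmod (x k)" "\<lambda>k. cmod (y k)" "{..<n}"]
          by (simp add: L2_set_def)
        finally show ?thesis .
      qed
      then show "\<exists>N. \<forall>n\<ge>N. sqrt (\<Sum>k<n. (cmod (x k + y k))\<^sup>2)
          \<le> sqrt (\<Sum>k<n. (cmod (x k))\<^sup>2) + sqrt (\<Sum>k<n. (cmod (y k))\<^sup>2)" by blast
    qed
  qed
  show "norm (r *\<^sub>R x) = \<bar>r\<bar> * norm x"
    unfolding scaleR_l2_def
    by transfer (simp add: norm_mult power_mult_distrib suminf_mult real_sqrt_mult)
  show "cinner x y = cnj (cinner y x)"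
  proof transfer
    fix x y :: "nat \<Rightarrow> complex"
    assume x: "summable (\<lambda>k. (cmod (x k))\<^sup>2)" and y: "summable (\<lambda>k. (cmod (y k))\<^sup>2)"
    have "(\<lambda>k. cnj (cnj (y k) * x k)) sums cnj (\<Sum>k. cnj (y k) * x k)"
      using summable_sums[OF summable_cnj_mult[OF y x]] by (simp only: sums_cnj)
    then show "(\<Sum>k. cnj (x k) * y k) = cnj (\<Sum>k. cnj (y k) * x k)"
      by (simp add: sums_iff mult.commute)
  qed
  show "cinner x (y + z) = cinner x y + cinner x z"
    by transfer (simp add: distrib_left suminf_add summable_cnj_mult)
  show "cinner x (a *\<^sub>C y) = a * cinner x y"
  proof transfer
    fix a :: complex and x y :: "nat \<Rightarrow> complex"
    assume x: "summable (\<lambda>k. (cmod (x k))\<^sup>2)" and y: "summable (\<lambda>k. (cmod (y k))\<^sup>2)"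
    show "(\<Sum>k. cnj (x k) * (a * y k)) = a * (\<Sum>k. cnj (x k) * y k)"
      using suminf_mult[OF summable_cnj_mult[OF x y], of a] by (simp add: mult.left_commute)
  qed
  show "cinner x x = complex_of_real ((norm x)\<^sup>2)"
  proof transfer
    fix x :: "nat \<Rightarrow> complex"
    assume x: "summable (\<lambda>k. (cmod (x k))\<^sup>2)"
    have "(\<lambda>k. complex_of_real ((cmod (x k))\<^sup>2)) sums complex_of_real (\<Sum>k. (cmod (x k))\<^sup>2)"
      using summable_sums[OF x] by (rule sums_of_real)
    moreover have "complex_of_real ((cmod (x k))\<^sup>2) = cnj (x k) * x k" for k
      by (metis complex_norm_square mult.commute)
    ultimately have "(\<Sum>k. cnj (x k) * x k) = complex_of_real (\<Sum>k. (cmod (x k))\<^sup>2)"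
      by (simp add: sums_iff)
    then show "(\<Sum>k. cnj (x k) * x k) = complex_of_real ((sqrt (\<Sum>k. (cmod (x k))\<^sup>2))\<^sup>2)"
      by (simp add: suminf_nonneg x)
  qed
qed

end

text \<open>Sequences are indexed from 0: \<open>fin_l2 m v\<close> is the vector \<open>(v 0, \<dots>, v (m - 1))\<close>
  of \<open>\<complex>\<^sup>m\<close>, extended by zero.\<close>

lift_definition fin_l2 :: "nat \<Rightarrow> (nat \<Rightarrow> complex) \<Rightarrow> l2" is "\<lambda>m v k. if k < m then v k else 0"
  by (rule summable_finite[of "{..<m}" for m]) auto

lift_definition unit_seq :: "nat \<Rightarrow> l2" is "\<lambda>j k. if k = j then 1 else 0"
  by (rule summable_finite[of "{j}" for j]) auto

definition Proj :: "nat \<Rightarrow> l2 \<Rightarrow> l2" where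
  "Proj n = orth_proj (cspan (unit_seq ` {..<n}))"

definition Proj_perp :: "nat \<Rightarrow> l2 \<Rightarrow> l2" where
  "Proj_perp n x = x - Proj n x"

text \<open>Only meaningful for matrices that map square-summable sequences to such; all others
  give unspecified values.\<close>

definition matrix_op :: "(nat \<Rightarrow> nat \<Rightarrow> complex) \<Rightarrow> l2 \<Rightarrow> l2" where
  "matrix_op u x = Abs_l2 (\<lambda>i. \<Sum>j. u i j * coord x j)"

text \<open>Convergence of the series is not part of the definition since it follows from the
  inequalities for finitely supported sequences; see \<open>riesz_basis_summable\<close>.\<close>

definition riesz_basis :: "'a::complex_inner set \<Rightarrow> (nat \<Rightarrow> 'a) \<Rightarrow> real \<Rightarrow> real \<Rightarrow> bool" where
  "riesz_basis V w A B \<longleftrightarrow> 0 < A \<and> 0 < B \<and> closure (cspan (range w)) = V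
     \<and> (\<forall>\<alpha>::l2. A * (\<Sum>k. (cmod (coord \<alpha> k))\<^sup>2) \<le> (norm (\<Sum>k. coord \<alpha> k *\<^sub>C w k))\<^sup>2
           \<and> (norm (\<Sum>k. coord \<alpha> k *\<^sub>C w k))\<^sup>2 \<le> B * (\<Sum>k. (cmod (coord \<alpha> k))\<^sup>2))"

lemma riesz_basis_summable:
  fixes w :: "nat \<Rightarrow> 'a::chilbert_space"
  assumes "riesz_basis V w A B"
  shows "summable (\<lambda>k. coord \<alpha> k *\<^sub>C w k)"
proof -
  have B: "0 < B"
    and ub: "\<And>\<alpha>::l2. (norm (\<Sum>k. coord \<alpha> k *\<^sub>C w k))\<^sup>2 \<le> B * (\<Sum>k. (cmod (coord \<alpha> k))\<^sup>2)"
    using assms by (auto simp: riesz_basis_def)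
  have fin: "(norm (\<Sum>k=p..<q. coord \<alpha> k *\<^sub>C w k))\<^sup>2 \<le> B * (\<Sum>k=p..<q. (cmod (coord \<alpha> k))\<^sup>2)" for p q
  proof -
    define \<gamma> where "\<gamma> = fin_l2 q (\<lambda>k. if p \<le> k then coord \<alpha> k else 0)"
    have c: "coord \<gamma> k = (if k \<in> {p..<q} then coord \<alpha> k else 0)" for k
      by (auto simp: \<gamma>_def fin_l2.rep_eq)
    have 1: "(\<Sum>k. coord \<gamma> k *\<^sub>C w k) = (\<Sum>k=p..<q. coord \<alpha> k *\<^sub>C w k)"
      by (subst suminf_finite[of "{p..<q}"]) (auto simp: c)
    have 2: "(\<Sum>k. (cmod (coord \<gamma> k))\<^sup>2) = (\<Sum>k=p..<q. (cmod (coord \<alpha> k))\<^sup>2)"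
      by (subst suminf_finite[of "{p..<q}"]) (auto simp: c)
    show ?thesis using ub[of \<gamma>] by (simp only: 1 2)
  qed
  show ?thesis
    unfolding summable_Cauchy
  proof (intro allI impI)
    fix r :: real assume r: "0 < r"
    then have "0 < r\<^sup>2 / B" using B by simp
    then obtain N where N: "\<And>p q. p \<ge> N \<Longrightarrow> norm (\<Sum>k=p..<q. (cmod (coord \<alpha> k))\<^sup>2) < r\<^sup>2 / B"
      using summable_coord[of \<alpha>] unfolding summable_Cauchy by blast
    have "norm (\<Sum>k=p..<q. coord \<alpha> k *\<^sub>C w k) < r" if "p \<ge> N" for p q
    proof -
      have "(\<Sum>k=p..<q. (cmod (coord \<alpha> k))\<^sup>2) < r\<^sup>2 / B" using N[OF that, of q] by simp
      then have "B * (\<Sum>k=p..<q. (cmod (coord \<alpha> k))\<^sup>2) < r\<^sup>2"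
        using B by (simp add: pos_less_divide_eq mult.commute)
      with fin[of p q] have "(norm (\<Sum>k=p..<q. coord \<alpha> k *\<^sub>C w k))\<^sup>2 < r\<^sup>2" by linarith
      then show ?thesis using r by (simp add: power_less_imp_less_base)
    qed
    then show "\<exists>N. \<forall>p\<ge>N. \<forall>q. norm (\<Sum>k=p..<q. coord \<alpha> k *\<^sub>C w k) < r" by blast
  qed
qed

text \<open>\<open>section_op U n m\<close> restricted to \<open>range (Proj n)\<close> is \<open>P\<^sub>nU\<^sup>*P\<^sub>mUP\<^sub>n|\<close> on
  \<open>P\<^sub>n l\<^sup>2(\<nat>)\<close>.\<close>

definition section_op :: "(l2 \<Rightarrow> l2) \<Rightarrow> nat \<Rightarrow> nat \<Rightarrow> l2 \<Rightarrow> l2" where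
  "section_op U n m = Proj n \<circ> cadjoint U \<circ> Proj m \<circ> U \<circ> Proj n"

definition K_const :: "(l2 \<Rightarrow> l2) \<Rightarrow> nat \<Rightarrow> nat \<Rightarrow> real" where
  "K_const U n m = onorm (inv_into (range (Proj n)) (section_op U n m)
     \<circ> Proj n \<circ> cadjoint U \<circ> Proj m \<circ> U \<circ> Proj_perp n)"

end

theory Submission
  imports Defs
begin

text \<open>Let \<open>T\<^sub>m = P\<^sub>nU\<^sup>*P\<^sub>mU\<close> on \<open>V = P\<^sub>nl\<^sup>2\<close>. Since \<open>\<langle>x, T\<^sub>mx\<rangle> = \<parallel>P\<^sub>mUx\<parallel>\<^sup>2\<close> for \<open>x \<in> V\<close>, the
  kernel of \<open>T\<^sub>m\<close> consists of the \<open>x \<in> V\<close> with \<open>P\<^sub>mUx = 0\<close>, so it decreases with \<open>m\<close>. Moreover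
  \<open>Ux = 0\<close> says that \<open>\<Sum>x\<^sub>kw\<^sub>k\<close> lies in \<open>W\<close> and is orthogonal to \<open>S\<close>, so \<open>U\<close> is injective; as \<open>V\<close> is
  finite-dimensional, \<open>U\<close> is bounded below on \<open>V\<close> and \<open>P\<^sub>mU\<close> is injective there for large \<open>m\<close>. When
  \<open>T\<^sub>m\<close> is invertible, the solution of the system is
  \<open>P\<^sub>n\<beta> + T\<^sub>m\<^sup>-\<^sup>1P\<^sub>nU\<^sup>*P\<^sub>mU(\<beta> - P\<^sub>n\<beta>)\<close>, which gives the error bound by the upper Riesz inequality.\<close>

section \<open>Complex inner products and bounded complex-linear maps\<close>

lemma cinner_add_left: "cinner (x + y) z = cinner x z + cinner y z"
  for x y z :: "'a::complex_inner"
  by (metis cinner_add_right cinner_commute complex_cnj_add)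

lemma cinner_scaleC_left: "cinner (a *\<^sub>C x) y = cnj a * cinner x y"
  for x y :: "'a::complex_inner"
  by (metis cinner_scaleC_right cinner_commute complex_cnj_mult)

lemma cinner_zero_right [simp]: "cinner x 0 = 0" for x :: "'a::complex_inner"
  using cinner_add_right[of x 0 0] by simp

lemma cinner_zero_left [simp]: "cinner 0 x = 0" for x :: "'a::complex_inner"
  using cinner_add_left[of 0 0 x] by simp

lemma cinner_diff_right: "cinner x (y - z) = cinner x y - cinner x z"
  for x y z :: "'a::complex_inner"
  using cinner_add_right[of x "y - z" z] by simp

lemma cinner_diff_left: "cinner (x - y) z = cinner x z - cinner y z"
  for x y z :: "'a::complex_inner"
  using cinner_add_left[of "x - y" y z] by simp

lemma cinner_same_eq_zero: "cinner x x = 0 \<longleftrightarrow> x = 0" for x :: "'a::complex_inner"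
  by (simp add: cinner_same)

text \<open>The class axioms make the norm homogeneous for real scalars only; the complex case is
  read off from \<open>cinner_same\<close>.\<close>

lemma norm_scaleC: "norm (a *\<^sub>C x) = cmod a * norm x" for x :: "'a::complex_inner"
proof -
  have "complex_of_real ((norm (a *\<^sub>C x))\<^sup>2) = complex_of_real ((cmod a * norm x)\<^sup>2)"
    unfolding cinner_same[symmetric] cinner_scaleC_left cinner_scaleC_right
    by (simp add: cinner_same power_mult_distrib complex_norm_square mult.commute
        mult.left_commute del: of_real_power)
  then show ?thesis by (simp only: of_real_eq_iff) (simp add: power2_eq_iff_nonneg)
qed

lemma cinner_Cauchy_Schwarz: "cmod (cinner x y) \<le> norm x * norm y"
  for x y :: "'a::complex_inner"
proof (cases "x = 0")
  case False
  \<comment> \<open>Up to the factor \<open>(norm x)\<^sup>2\<close>, which avoids a division,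
    \<open>z\<close> is the component of \<open>y\<close> orthogonal to \<open>x\<close>. The
    inequality comes from \<open>0 \<le> (norm z)\<^sup>2\<close>.\<close>
  define z where "z = complex_of_real ((norm x)\<^sup>2) *\<^sub>C y - cinner x y *\<^sub>C x"
  have xz: "cinner x z = 0"
    by (simp add: z_def cinner_diff_right cinner_scaleC_right cinner_same)
  have zy: "cinner z y = complex_of_real ((norm x)\<^sup>2 * (norm y)\<^sup>2 - (cmod (cinner x y))\<^sup>2)"
  proof -
    have "cinner z y = complex_of_real ((norm x)\<^sup>2) * cinner y y - cnj (cinner x y) * cinner x y"
      by (simp add: z_def cinner_diff_left cinner_scaleC_left)
    then show ?thesis
      unfolding cinner_same of_real_diff of_real_mult complex_norm_square[of "cinner x y"]
      by (simp only: mult.commute)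
  qed
  have "complex_of_real ((norm z)\<^sup>2) = complex_of_real ((norm x)\<^sup>2) * cinner z y
      - cinner x y * cinner z x"
    using arg_cong[OF z_def, of "cinner z"]
    by (simp only: cinner_same[symmetric] cinner_diff_right cinner_scaleC_right)
  also have "cinner z x = 0" using xz cinner_commute[of z x] by simp
  finally have "(norm z)\<^sup>2 = (norm x)\<^sup>2 * ((norm x)\<^sup>2 * (norm y)\<^sup>2 - (cmod (cinner x y))\<^sup>2)"
    unfolding zy mult_zero_right diff_zero of_real_mult[symmetric] of_real_eq_iff .
  then have "0 \<le> (norm x)\<^sup>2 * ((norm x)\<^sup>2 * (norm y)\<^sup>2 - (cmod (cinner x y))\<^sup>2)"
    by (metis zero_le_power2)
  then have "(cmod (cinner x y))\<^sup>2 \<le> (norm x * norm y)\<^sup>2"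
    using False by (simp add: zero_le_mult_iff power_mult_distrib)
  then show ?thesis by (rule power2_le_imp_le) simp
qed simp

lemma bounded_linear_cinner_right: "bounded_linear (cinner x)" for x :: "'a::complex_inner"
proof (rule bounded_linear_intro)
  show "norm (cinner x y) \<le> norm y * norm x" for y
    using cinner_Cauchy_Schwarz[of x y] by (simp add: mult.commute)
qed (simp_all add: cinner_add_right scaleR_scaleC cinner_scaleC_right scaleR_conv_of_real)

lemma bounded_linear_scaleC: "bounded_linear ((*\<^sub>C) a :: 'a::complex_inner \<Rightarrow> 'a)"
  by (rule bounded_linear_intro[of _ "cmod a"])
    (simp_all add: scaleC_add_right scaleR_scaleC scaleC_scaleC norm_scaleC mult.commute)

text \<open>Complex homogeneity is recorded because \<open>cspan\<close> and
  \<open>bounded_op_on\<close> work over complex scalars; \<open>bounded_linear\<close> then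
  follows.\<close>

definition bounded_clinear :: "('a::complex_inner \<Rightarrow> 'b::complex_inner) \<Rightarrow> bool" where
  "bounded_clinear T \<longleftrightarrow> (\<forall>x y. T (x + y) = T x + T y) \<and> (\<forall>a x. T (a *\<^sub>C x) = a *\<^sub>C T x)
     \<and> (\<exists>K. \<forall>x. norm (T x) \<le> K * norm x)"

lemma bounded_clinearI:
  assumes "\<And>x y. T (x + y) = T x + T y" "\<And>a x. T (a *\<^sub>C x) = a *\<^sub>C T x"
    "\<And>x. norm (T x) \<le> K * norm x"
  shows "bounded_clinear T"
  using assms unfolding bounded_clinear_def by blast

lemma bounded_clinear_add: "bounded_clinear T \<Longrightarrow> T (x + y) = T x + T y"
  by (simp add: bounded_clinear_def)

lemma bounded_clinear_scaleC: "bounded_clinear T \<Longrightarrow> T (a *\<^sub>C x) = a *\<^sub>C T x"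
  by (simp add: bounded_clinear_def)

lemma bounded_clinear_imp_bounded_linear:
  assumes "bounded_clinear T" shows "bounded_linear T"
proof -
  obtain K where "\<And>x. norm (T x) \<le> K * norm x" using assms by (auto simp: bounded_clinear_def)
  then show ?thesis
    by (intro bounded_linear_intro[of _ K])
      (simp_all add: bounded_clinear_add bounded_clinear_scaleC assms scaleR_scaleC mult.commute)
qed

lemmas bounded_clinear_zero = linear_0[OF bounded_linear.linear[OF bounded_clinear_imp_bounded_linear]]
lemmas bounded_clinear_diff = linear_diff[OF bounded_linear.linear[OF bounded_clinear_imp_bounded_linear]]

lemma bounded_clinear_compose:
  assumes T: "bounded_clinear T" and R: "bounded_clinear R"
  shows "bounded_clinear (T \<circ> R)"
proof -
  have "bounded_linear (\<lambda>x. T (R x))"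
    by (rule bounded_linear_compose[OF bounded_clinear_imp_bounded_linear[OF T]
          bounded_clinear_imp_bounded_linear[OF R]])
  then obtain K where "\<And>x. norm (T (R x)) \<le> norm x * K"
    using bounded_linear.bounded by blast
  then show ?thesis
    by (intro bounded_clinearI[of _ K])
      (simp_all add: bounded_clinear_add bounded_clinear_scaleC T R mult.commute)
qed

section \<open>Truncations of square-summable sequences\<close>

lemma norm_l2_square: "(norm x)\<^sup>2 = (\<Sum>k. (cmod (coord x k))\<^sup>2)" for x :: l2
  by (simp add: norm_l2.rep_eq suminf_nonneg summable_coord)

lemma coord_eqI: "(\<And>k. coord x k = coord y k) \<Longrightarrow> x = y"
  by (meson coord_inject ext)

lemma coord_zero [simp]: "coord 0 k = 0" by (simp add: zero_l2.rep_eq)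
lemma coord_add [simp]: "coord (x + y) k = coord x k + coord y k" by (simp add: plus_l2.rep_eq)
lemma coord_scaleC [simp]: "coord (a *\<^sub>C x) k = a * coord x k" by (simp add: scaleC_l2.rep_eq)
lemma coord_diff [simp]: "coord (x - y) k = coord x k - coord y k"
  using coord_add[of "x - y" y k] by simp
lemma coord_sum [simp]: "coord (\<Sum>i\<in>I. g i) k = (\<Sum>i\<in>I. coord (g i) k)"
  by (induction I rule: infinite_finite_induct) simp_all

lemma coord_Abs_l2: "summable (\<lambda>k. (cmod (x k))\<^sup>2) \<Longrightarrow> coord (Abs_l2 x) = x"
  by (simp add: Abs_l2_inverse)

lemma cmod_coord_le_norm: "cmod (coord x k) \<le> norm x"
proof (rule power2_le_imp_le)
  show "(cmod (coord x k))\<^sup>2 \<le> (norm x)\<^sup>2"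
    using sum_le_suminf[OF summable_coord, of "{k}" x] by (simp add: norm_l2_square)
qed simp

lemma norm_l2_le:
  assumes "\<And>N. (\<Sum>k<N. (cmod (coord x k))\<^sup>2) \<le> K\<^sup>2" "0 \<le> K"
  shows "norm x \<le> K"
proof (rule power2_le_imp_le)
  show "(norm x)\<^sup>2 \<le> K\<^sup>2"
    unfolding norm_l2_square by (rule suminf_le_const[OF summable_coord assms(1)])
qed (fact assms(2))

lemma coord_unit_seq: "coord (unit_seq j) k = (if k = j then 1 else 0)"
  by (simp add: unit_seq.rep_eq)

lemma coord_fin_l2 [simp]: "coord (fin_l2 m v) k = (if k < m then v k else 0)"
  by (simp add: fin_l2.rep_eq)

lemma fin_l2_eq_sum: "fin_l2 n v = (\<Sum>k<n. v k *\<^sub>C unit_seq k)"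
  by (rule coord_eqI) (simp add: coord_unit_seq if_distrib cong: if_cong)

lemma fin_l2_in_span: "fin_l2 n v \<in> cspan (unit_seq ` {..<n})"
  unfolding fin_l2_eq_sum
  by (intro complex_vector.span_sum complex_vector.span_scale complex_vector.span_base) simp

lemma coord_eq_zero_span_unit_seq:
  assumes "x \<in> cspan (unit_seq ` {..<n})" "n \<le> k"
  shows "coord x k = 0"
  using assms by (induction rule: complex_vector.span_induct_alt) (auto simp: coord_unit_seq)

lemma cinner_unit_seq: "cinner (unit_seq j) x = coord x j"
proof -
  have "(\<Sum>k. cnj (coord (unit_seq j) k) * coord x k) = (\<Sum>k\<in>{j}. cnj (coord (unit_seq j) k) * coord x k)"
    by (rule suminf_finite) (auto simp: coord_unit_seq)
  then show ?thesis by (simp add: cinner_l2.rep_eq coord_unit_seq)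
qed

text \<open>\<open>orth_proj\<close> is a definite description, so existence and uniqueness are both
  at stake. The residual of the truncation vanishes below \<open>n\<close>, where the vectors of the
  span live. Conversely, pairing the residual with the unit vectors fixes the first \<open>n\<close>
  coordinates, and membership in the span makes the others zero.\<close>

lemma Proj_eq: "Proj n x = fin_l2 n (coord x)"
  unfolding Proj_def orth_proj_def
proof (rule the_equality)
  let ?V = "cspan (unit_seq ` {..<n})"
  have "cinner v (x - fin_l2 n (coord x)) = 0" if "v \<in> ?V" for v
  proof -
    have "cnj (coord v k) * coord (x - fin_l2 n (coord x)) k = 0" for k
      using coord_eq_zero_span_unit_seq[OF that, of k] by auto
    then show ?thesis by (simp only: cinner_l2.rep_eq suminf_zero)
  qed
  then show "fin_l2 n (coord x) \<in> ?V \<and> x - fin_l2 n (coord x) \<in> orth_compl ?V"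
    by (simp add: fin_l2_in_span orth_compl_def)
next
  fix y
  assume y: "y \<in> cspan (unit_seq ` {..<n}) \<and> x - y \<in> orth_compl (cspan (unit_seq ` {..<n}))"
  show "y = fin_l2 n (coord x)"
  proof (rule coord_eqI)
    fix k
    show "coord y k = coord (fin_l2 n (coord x)) k"
    proof (cases "k < n")
      case True
      then have "unit_seq k \<in> cspan (unit_seq ` {..<n})"
        by (intro complex_vector.span_base) simp
      then have "cinner (unit_seq k) (x - y) = 0" using y by (simp add: orth_compl_def)
      then show ?thesis using True by (simp add: cinner_unit_seq)
    next
      case False
      then show ?thesis using y coord_eq_zero_span_unit_seq[of y n k] by simp
    qed
  qed
qed

lemma coord_Proj [simp]: "coord (Proj n x) k = (if k < n then coord x k else 0)"
  by (simp add: Proj_eq)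

lemma Proj_Proj [simp]: "Proj n (Proj n x) = Proj n x"
  by (rule coord_eqI) simp

lemma in_range_Proj_iff: "x \<in> range (Proj n) \<longleftrightarrow> Proj n x = x"
  by (metis Proj_Proj rangeE rangeI)

lemma range_Proj_eq_span: "range (Proj n) = cspan (unit_seq ` {..<n})"
proof (intro equalityI subsetI)
  fix x assume "x \<in> cspan (unit_seq ` {..<n})"
  then have "Proj n x = x" by (intro coord_eqI) (auto simp: coord_eq_zero_span_unit_seq)
  then show "x \<in> range (Proj n)" by (metis rangeI)
qed (auto simp: Proj_eq fin_l2_in_span)

lemma norm_Proj_le: "norm (Proj n x) \<le> norm x"
proof (rule power2_le_imp_le)
  show "(norm (Proj n x))\<^sup>2 \<le> (norm x)\<^sup>2"
    unfolding norm_l2_square by (intro suminf_le summable_coord) simp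
qed simp

lemma Proj_add: "Proj n (x + y) = Proj n x + Proj n y" by (rule coord_eqI) simp
lemma Proj_diff: "Proj n (x - y) = Proj n x - Proj n y" by (rule coord_eqI) simp
lemma Proj_scaleC: "Proj n (a *\<^sub>C x) = a *\<^sub>C Proj n x" by (rule coord_eqI) simp

lemma bounded_clinear_Proj: "bounded_clinear (Proj n)"
  by (rule bounded_clinearI[of _ 1]) (simp_all add: Proj_add Proj_scaleC norm_Proj_le)

lemma bounded_clinear_Proj_perp: "bounded_clinear (Proj_perp n)"
proof (rule bounded_clinearI[of _ 2])
  show "norm (Proj_perp n x) \<le> 2 * norm x" for x
    using norm_triangle_ineq4[of x "Proj n x"] norm_Proj_le[of n x] by (simp add: Proj_perp_def)
qed (simp_all add: Proj_perp_def Proj_add Proj_scaleC complex_vector.scale_right_diff_distrib)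

lemma cinner_Proj: "cinner (Proj n x) y = cinner x (Proj n y)"
proof -
  have "cnj (coord (Proj n x) k) * coord y k = cnj (coord x k) * coord (Proj n y) k" for k
    by simp
  then show ?thesis by (simp only: cinner_l2.rep_eq)
qed

text \<open>The squared error is the tail of the convergent series for
  \<open>(norm x)\<^sup>2\<close>.\<close>

lemma tendsto_Proj: "(\<lambda>m. Proj m x) \<longlonglongrightarrow> x"
proof -
  have "(norm (x - Proj m x))\<^sup>2 = (norm x)\<^sup>2 - (\<Sum>k<m. (cmod (coord x k))\<^sup>2)" for m
  proof -
    have "(\<lambda>k. (cmod (coord x k))\<^sup>2 - (if k \<in> {..<m} then (cmod (coord x k))\<^sup>2 else 0)) sums
        ((norm x)\<^sup>2 - (\<Sum>k<m. (cmod (coord x k))\<^sup>2))"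
      by (intro sums_diff sums_If_finite_set) (simp_all add: norm_l2_square summable_sums summable_coord)
    moreover have "(cmod (coord x k))\<^sup>2 - (if k \<in> {..<m} then (cmod (coord x k))\<^sup>2 else 0)
        = (cmod (coord (x - Proj m x) k))\<^sup>2" for k by simp
    ultimately show ?thesis by (simp add: sums_iff norm_l2_square)
  qed
  moreover have "(\<lambda>m. (norm x)\<^sup>2 - (\<Sum>k<m. (cmod (coord x k))\<^sup>2)) \<longlonglongrightarrow> (norm x)\<^sup>2 - (norm x)\<^sup>2"
    unfolding norm_l2_square by (intro tendsto_intros summable_LIMSEQ summable_coord)
  ultimately have "(\<lambda>m. (norm (x - Proj m x))\<^sup>2) \<longlonglongrightarrow> 0" by simp
  then have "(\<lambda>m. norm (x - Proj m x)) \<longlonglongrightarrow> 0"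
    using tendsto_real_sqrt by fastforce
  then show ?thesis
    by (subst tendsto_dist_iff) (simp add: dist_norm norm_minus_commute)
qed

section \<open>Operators on the range of a truncation\<close>

text \<open>Expand \<open>x\<close> in the unit vectors and bound each coordinate by
  \<open>norm x\<close>. Linearity is required on the range only, so that \<open>R\<close> may be an
  \<open>inv_into\<close>, which is arbitrary elsewhere. The explicit constant matters when
  \<open>R\<close> is the difference of \<open>U\<close> and its truncation: it then tends to
  zero.\<close>

lemma norm_image_range_Proj_le:
  fixes R :: "l2 \<Rightarrow> 'a::complex_inner"
  assumes "\<And>x y. x \<in> range (Proj n) \<Longrightarrow> y \<in> range (Proj n) \<Longrightarrow> R (x + y) = R x + R y"
    and "\<And>a x. x \<in> range (Proj n) \<Longrightarrow> R (a *\<^sub>C x) = a *\<^sub>C R x"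
    and "x \<in> range (Proj n)"
  shows "norm (R x) \<le> (\<Sum>k<n. norm (R (unit_seq k))) * norm x"
proof -
  let ?V = "range (Proj n)"
  have V: "0 \<in> ?V" "\<And>x y. x \<in> ?V \<Longrightarrow> y \<in> ?V \<Longrightarrow> x + y \<in> ?V" "\<And>a x. x \<in> ?V \<Longrightarrow> a *\<^sub>C x \<in> ?V"
    unfolding range_Proj_eq_span
    by (simp_all add: complex_vector.span_zero complex_vector.span_add complex_vector.span_scale)
  have R0: "R 0 = 0" using assms(1)[of 0 0] V(1) by simp
  have e: "unit_seq k \<in> ?V" if "k < n" for k
    unfolding range_Proj_eq_span using that by (intro complex_vector.span_base) simp
  \<comment> \<open>Membership is carried through the induction because \<open>R\<close> is additive
    only inside \<open>?V\<close>.\<close>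
  have "(\<Sum>k<m. coord x k *\<^sub>C unit_seq k) \<in> ?V \<and>
      R (\<Sum>k<m. coord x k *\<^sub>C unit_seq k) = (\<Sum>k<m. coord x k *\<^sub>C R (unit_seq k))" if "m \<le> n" for m
    using that by (induction m) (simp_all add: R0 V e assms(1,2))
  moreover have "x = (\<Sum>k<n. coord x k *\<^sub>C unit_seq k)"
    using assms(3) unfolding in_range_Proj_iff by (metis Proj_eq fin_l2_eq_sum)
  ultimately have "R x = (\<Sum>k<n. coord x k *\<^sub>C R (unit_seq k))" by (metis order_refl)
  also have "norm \<dots> \<le> (\<Sum>k<n. norm x * norm (R (unit_seq k)))"
    by (intro sum_norm_le) (simp add: norm_scaleC mult_right_mono cmod_coord_le_norm)
  finally show ?thesis by (simp add: sum_distrib_left[symmetric] mult.commute)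
qed

text \<open>Dimension count: \<open>T\<close> maps the unit vectors to \<open>n\<close> independent
  vectors. A vector of the range outside their span would give \<open>n + 1\<close> independent
  vectors in the span of \<open>n\<close>.\<close>

lemma bij_betw_range_Proj:
  assumes T: "bounded_clinear T" and TV: "T ` range (Proj n) \<subseteq> range (Proj n)"
    and inj: "\<And>x. x \<in> range (Proj n) \<Longrightarrow> T x = 0 \<Longrightarrow> x = 0"
  shows "bij_betw T (range (Proj n)) (range (Proj n))"
proof -
  let ?V = "range (Proj n)"
  let ?B = "unit_seq ` {..<n}"
  have lin: "Vector_Spaces.linear scaleC scaleC T"
    by unfold_locales (simp_all add: bounded_clinear_add bounded_clinear_scaleC T)
  have VB: "?V = cspan ?B" by (rule range_Proj_eq_span)
  have injV: "inj_on T ?V"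
  proof (rule inj_onI)
    fix x y assume xy: "x \<in> ?V" "y \<in> ?V" "T x = T y"
    then have "x - y \<in> ?V" unfolding VB by (simp add: complex_vector.span_diff)
    then show "x = y" using inj[of "x - y"] xy bounded_clinear_diff[OF T] by simp
  qed
  have indepB: "complex_vector.independent ?B"
    unfolding complex_vector.independent_explicit_module
  proof (intro allI impI)
    fix t u v assume t: "finite t" "t \<subseteq> ?B" "(\<Sum>v\<in>t. u v *\<^sub>C v) = 0" "v \<in> t"
    obtain j where v: "v = unit_seq j" using t by auto
    \<comment> \<open>Coordinate \<open>j\<close> isolates the coefficient of \<open>v\<close> in
      the vanishing combination.\<close>
    have z: "coord w j = (if w = v then 1 else 0)" if "w \<in> t" for w
      using that t(2) v by (auto simp: coord_unit_seq)
    have "0 = coord (\<Sum>v\<in>t. u v *\<^sub>C v) j" by (simp add: t(3))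
    also have "\<dots> = (\<Sum>w\<in>t. if w = v then u w else 0)"
      by (auto intro!: sum.cong simp: z)
    also have "\<dots> = u v" using t by simp
    finally show "u v = 0" by simp
  qed
  have indepT: "complex_vector.independent (T ` ?B)"
  proof -
    interpret Vector_Spaces.linear scaleC scaleC T by (rule lin)
    show ?thesis
      using indepB injV unfolding VB cspan_def by (rule independent_injective_image)
  qed
  have "?V \<subseteq> cspan (T ` ?B)"
  proof (rule ccontr)
    assume "\<not> ?V \<subseteq> cspan (T ` ?B)"
    then obtain v where v: "v \<in> ?V" "v \<notin> cspan (T ` ?B)" by blast
    have "complex_vector.independent (insert v (T ` ?B))"
      by (rule complex_vector.independent_insertI[OF v(2) indepT])
    moreover have "insert v (T ` ?B) \<subseteq> cspan ?B"
      using v(1) TV complex_vector.span_superset[of ?B] unfolding VB by blast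
    ultimately have "card (insert v (T ` ?B)) \<le> card ?B"
      using complex_vector.independent_span_bound by blast
    moreover have "v \<notin> T ` ?B" by (rule contrapos_nn[OF v(2) complex_vector.span_base])
    moreover have "card (T ` ?B) = card ?B"
      by (rule card_image[OF inj_on_subset[OF injV]]) (simp add: VB complex_vector.span_superset)
    ultimately show False by simp
  qed
  also have "cspan (T ` ?B) = T ` ?V"
  proof -
    interpret Vector_Spaces.linear scaleC scaleC T by (rule lin)
    show ?thesis unfolding VB cspan_def by (rule span_image)
  qed
  finally show ?thesis using injV TV by (simp add: bij_betw_def subset_antisym)
qed

lemma bounded_op_on_inv_into:
  assumes T: "bounded_clinear T" and bij: "bij_betw T (range (Proj n)) (range (Proj n))"
  shows "bounded_op_on (range (Proj n)) (inv_into (range (Proj n)) T)"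
proof -
  let ?V = "range (Proj n)"
  let ?R = "inv_into ?V T"
  have V: "\<And>x y. x \<in> ?V \<Longrightarrow> y \<in> ?V \<Longrightarrow> x + y \<in> ?V" "\<And>a x. x \<in> ?V \<Longrightarrow> a *\<^sub>C x \<in> ?V"
    unfolding range_Proj_eq_span
    by (simp_all add: complex_vector.span_add complex_vector.span_scale)
  have R: "?R x \<in> ?V" "T (?R x) = x" if "x \<in> ?V" for x
    using bij that by (simp_all add: bij_betw_def inv_into_into f_inv_into_f)
  \<comment> \<open>By injectivity, additivity and homogeneity of \<open>?R\<close> can be checked
    after applying \<open>T\<close>.\<close>
  have eq: "?R y = x" if "x \<in> ?V" "T x = y" for x y
    using bij that by (auto simp: bij_betw_def inv_into_f_f)
  have add: "?R (x + y) = ?R x + ?R y" if "x \<in> ?V" "y \<in> ?V" for x y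
    by (rule eq) (simp_all only: V R that bounded_clinear_add[OF T])
  have scale: "?R (a *\<^sub>C x) = a *\<^sub>C ?R x" if "x \<in> ?V" for a x
    by (rule eq) (simp_all only: V R that bounded_clinear_scaleC[OF T])
  have "norm (?R x) \<le> (\<Sum>k<n. norm (?R (unit_seq k))) * norm x" if "x \<in> ?V" for x
    using add scale that by (rule norm_image_range_Proj_le)
  then show ?thesis unfolding bounded_op_on_def using R(1) add scale by blast
qed

text \<open>In finite dimension a trivial kernel already gives a bounded inverse, so the spectral
  condition becomes one on the kernel.\<close>

lemma zero_notin_spectrum_on_range_Proj_iff:
  assumes T: "bounded_clinear T" and TV: "T ` range (Proj n) \<subseteq> range (Proj n)"
  shows "0 \<notin> spectrum_on (range (Proj n)) T \<longleftrightarrow> (\<forall>x\<in>range (Proj n). T x = 0 \<longrightarrow> x = 0)"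
proof
  assume "0 \<notin> spectrum_on (range (Proj n)) T"
  then obtain R where R: "bounded_op_on (range (Proj n)) R" "\<And>x. x \<in> range (Proj n) \<Longrightarrow> R (T x) = x"
    by (auto simp: spectrum_on_def)
  have 0: "0 \<in> range (Proj n)"
    unfolding range_Proj_eq_span by (rule complex_vector.span_zero)
  have "R 0 = 0" using R(2)[OF 0] by (simp add: bounded_clinear_zero T)
  then show "\<forall>x\<in>range (Proj n). T x = 0 \<longrightarrow> x = 0" using R(2) by metis
next
  assume "\<forall>x\<in>range (Proj n). T x = 0 \<longrightarrow> x = 0"
  then have bij: "bij_betw T (range (Proj n)) (range (Proj n))"
    using T TV by (intro bij_betw_range_Proj) auto
  then have "bounded_op_on (range (Proj n)) (inv_into (range (Proj n)) T)"
    by (rule bounded_op_on_inv_into[OF T])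
  moreover have "\<forall>x\<in>range (Proj n). inv_into (range (Proj n)) T (T x) = x
      \<and> T (inv_into (range (Proj n)) T x) = x"
    using bij by (simp add: bij_betw_def f_inv_into_f inv_into_f_f)
  ultimately show "0 \<notin> spectrum_on (range (Proj n)) T"
    unfolding spectrum_on_def by auto
qed

text \<open>\<open>R\<close> is controlled on \<open>V\<close> only, but \<open>T\<close> maps
  everything into \<open>V\<close>, so the composite is bounded linear globally. This is what makes
  the \<open>onorm\<close> in \<open>K_const\<close> an actual bound.\<close>

lemma bounded_linear_compose_bounded_op_on:
  assumes R: "bounded_op_on V R" and T: "bounded_clinear T" and TV: "range T \<subseteq> V"
  shows "bounded_linear (R \<circ> T)"
proof -
  obtain K where K: "\<And>x. x \<in> V \<Longrightarrow> norm (R x) \<le> K * norm x"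
    using R unfolding bounded_op_on_def by blast
  obtain L where L: "\<And>x. norm (T x) \<le> L * norm x"
    using T by (auto simp: bounded_clinear_def)
  have V: "T x \<in> V" for x using TV by auto
  show ?thesis
  proof (rule bounded_linear_intro[of _ "\<bar>K\<bar> * L"])
    fix x
    have "norm (R (T x)) \<le> K * norm (T x)" by (rule K[OF V])
    \<comment> \<open>The sign of \<open>K\<close> is unknown (on the zero space any real number
      serves), hence the absolute value.\<close>
    also have "\<dots> \<le> \<bar>K\<bar> * norm (T x)" by (simp add: mult_right_mono)
    also have "\<dots> \<le> \<bar>K\<bar> * (L * norm x)" by (simp add: mult_left_mono L)
    finally show "norm ((R \<circ> T) x) \<le> norm x * (\<bar>K\<bar> * L)" by (simp add: ac_simps)
  qed (use R in \<open>simp_all add: bounded_op_on_def V bounded_clinear_add[OF T]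
      bounded_clinear_scaleC[OF T] scaleR_scaleC\<close>)
qed

section \<open>Synthesis and cross-Gram operators of Riesz bases\<close>

definition synth :: "(nat \<Rightarrow> 'a::complex_inner) \<Rightarrow> l2 \<Rightarrow> 'a" where
  "synth w x = (\<Sum>k. coord x k *\<^sub>C w k)"

lemma synth_Proj: "synth w (Proj n x) = (\<Sum>k<n. coord x k *\<^sub>C w k)"
  unfolding synth_def by (subst suminf_finite[of "{..<n}"]) auto

lemma bounded_clinear_synth:
  fixes w :: "nat \<Rightarrow> 'a::chilbert_space"
  assumes w: "riesz_basis V w A B"
  shows "norm (synth w x) \<le> sqrt B * norm x" "bounded_clinear (synth w)"
proof -
  have le: "norm (synth w x) \<le> sqrt B * norm x" for x
  proof (rule power2_le_imp_le)
    show "(norm (synth w x))\<^sup>2 \<le> (sqrt B * norm x)\<^sup>2"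
      using w by (simp add: riesz_basis_def synth_def norm_l2_square power_mult_distrib)
  qed (use w in \<open>simp add: riesz_basis_def\<close>)
  then show "norm (synth w x) \<le> sqrt B * norm x" .
  note sm = riesz_basis_summable[OF w]
  show "bounded_clinear (synth w)"
  proof (rule bounded_clinearI[OF _ _ le])
    show "synth w (x + y) = synth w x + synth w y" for x y
      unfolding synth_def by (simp add: suminf_add sm scaleC_add_left)
    show "synth w (a *\<^sub>C x) = a *\<^sub>C synth w x" for a x
      unfolding synth_def
      by (simp add: bounded_linear.suminf[OF bounded_linear_scaleC sm] scaleC_scaleC)
  qed
qed

lemma synth_eq_zero:
  assumes w: "riesz_basis V w A B" and "synth w x = 0"
  shows "x = 0"
proof -
  have "A * (norm x)\<^sup>2 \<le> 0" "0 < A"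
    using w assms(2) by (auto simp: riesz_basis_def synth_def norm_l2_square dest!: spec[of _ x])
  then show ?thesis by (simp add: mult_le_0_iff)
qed

lemma synth_in:
  fixes w :: "nat \<Rightarrow> 'a::chilbert_space"
  assumes w: "riesz_basis V w A B"
  shows "synth w x \<in> V"
proof -
  have "(\<lambda>n. \<Sum>k<n. coord x k *\<^sub>C w k) \<longlonglongrightarrow> synth w x"
    unfolding synth_def by (rule summable_LIMSEQ[OF riesz_basis_summable[OF w]])
  moreover have "(\<Sum>k<n. coord x k *\<^sub>C w k) \<in> cspan (range w)" for n
    by (intro complex_vector.span_sum complex_vector.span_scale complex_vector.span_base) simp
  ultimately have "synth w x \<in> closure (cspan (range w))"
    unfolding closure_sequential by (intro exI[of _ "\<lambda>n. \<Sum>k<n. coord x k *\<^sub>C w k"]) simp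
  then show ?thesis using w by (simp add: riesz_basis_def)
qed

lemma cinner_synth_sums:
  fixes w :: "nat \<Rightarrow> 'a::chilbert_space"
  assumes w: "riesz_basis V w A B"
  shows "(\<lambda>k. cinner g (w k) * coord x k) sums cinner g (synth w x)"
  using bounded_linear.sums[OF bounded_linear_cinner_right
      summable_sums[OF riesz_basis_summable[OF w]], of g x]
  by (simp add: synth_def cinner_scaleC_right mult.commute)

text \<open>Pairing \<open>g\<close> with the partial sum \<open>\<Sum>i<N. \<langle>s\<^sub>i, g\<rangle> s\<^sub>i\<close> turns the upper Riesz bound into
  Bessel's inequality.\<close>

lemma riesz_basis_Bessel:
  fixes s :: "nat \<Rightarrow> 'a::chilbert_space"
  assumes s: "riesz_basis V s C D"
  shows "(\<Sum>i<N. (cmod (cinner (s i) g))\<^sup>2) \<le> (sqrt D * norm g)\<^sup>2"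
proof -
  define x where "x = fin_l2 N (\<lambda>i. cinner (s i) g)"
  define c where "c = (\<Sum>i<N. (cmod (cinner (s i) g))\<^sup>2)"
  have nx: "(norm x)\<^sup>2 = c"
    unfolding norm_l2_square x_def c_def by (subst suminf_finite[of "{..<N}"]) auto
  have "cinner g (synth s x) = (\<Sum>i. cinner g (s i) * coord x i)"
    using cinner_synth_sums[OF s] by (simp add: sums_iff)
  also have "\<dots> = (\<Sum>i<N. cinner g (s i) * cinner (s i) g)"
    unfolding x_def by (subst suminf_finite[of "{..<N}"]) auto
  also have "\<dots> = (\<Sum>i<N. complex_of_real ((cmod (cinner (s i) g))\<^sup>2))"
    by (intro sum.cong refl) (metis complex_norm_square cinner_commute mult.commute)
  also have "\<dots> = complex_of_real c" by (simp add: c_def)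
  finally have eq: "cinner g (synth s x) = complex_of_real c" .
  have "(norm x)\<^sup>2 \<le> cmod (cinner g (synth s x))" unfolding eq nx by simp
  also have "\<dots> \<le> norm g * norm (synth s x)" by (rule cinner_Cauchy_Schwarz)
  also have "\<dots> \<le> norm g * (sqrt D * norm x)"
    by (intro mult_left_mono bounded_clinear_synth(1)[OF s]) simp
  finally have "norm x * norm x \<le> (sqrt D * norm g) * norm x"
    by (simp add: power2_eq_square ac_simps)
  moreover have "0 \<le> sqrt D * norm g" using s by (simp add: riesz_basis_def)
  ultimately have "norm x \<le> sqrt D * norm g"
    \<comment> \<open>One factor \<open>norm x\<close> is cancelled; if it is zero, the bound is
      trivial.\<close>
    by (cases "norm x = 0") (auto simp: mult_le_cancel_right)
  then show ?thesis unfolding c_def[symmetric] nx[symmetric] by (simp add: power_mono)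
qed

text \<open>Continuity of the inner product sums each row to
  \<open>cinner (s i) (synth w x)\<close>. Since \<open>Abs_l2\<close> is unspecified off the
  square-summable sequences, Bessel's inequality is needed before a coordinate can be read.\<close>

lemma coord_cross_gram:
  fixes s w :: "nat \<Rightarrow> 'a::chilbert_space"
  assumes w: "riesz_basis W w A B" and s: "riesz_basis S s C D"
  shows "coord (matrix_op (\<lambda>i j. cinner (s i) (w j)) x) i = cinner (s i) (synth w x)"
proof -
  have "matrix_op (\<lambda>i j. cinner (s i) (w j)) x = Abs_l2 (\<lambda>i. cinner (s i) (synth w x))"
    unfolding matrix_op_def using cinner_synth_sums[OF w] by (simp add: sums_iff)
  moreover have "summable (\<lambda>i. (cmod (cinner (s i) (synth w x)))\<^sup>2)"
    \<comment> \<open>\<open>bounded_imp_summable\<close> sums over \<open>{..k}\<close>, Bessel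
      over \<open>{..<N}\<close>; hence \<open>Suc\<close>.\<close>
    using riesz_basis_Bessel[OF s, where N = "Suc _"]
    by (intro bounded_imp_summable[of _ "(sqrt D * norm (synth w x))\<^sup>2"])
      (simp_all only: lessThan_Suc_atMost zero_le_power2)
  ultimately show ?thesis by (simp add: coord_Abs_l2)
qed

lemma bounded_clinear_cross_gram:
  fixes s w :: "nat \<Rightarrow> 'a::chilbert_space"
  assumes w: "riesz_basis W w A B" and s: "riesz_basis S s C D"
  shows "bounded_clinear (matrix_op (\<lambda>i j. cinner (s i) (w j)))" (is "bounded_clinear ?U")
proof (rule bounded_clinearI[of _ "sqrt D * sqrt B"])
  note c = coord_cross_gram[OF w s]
  note W = bounded_clinear_synth[OF w]
  show "?U (x + y) = ?U x + ?U y" for x y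
    by (rule coord_eqI) (simp add: c bounded_clinear_add[OF W(2)] cinner_add_right)
  show "?U (a *\<^sub>C x) = a *\<^sub>C ?U x" for a x
    by (rule coord_eqI) (simp add: c bounded_clinear_scaleC[OF W(2)] cinner_scaleC_right)
  fix x
  have D: "0 \<le> D" using s by (simp add: riesz_basis_def)
  have "norm (?U x) \<le> sqrt D * norm (synth w x)"
    by (rule norm_l2_le) (unfold c, rule riesz_basis_Bessel[OF s], use D in simp)
  also have "\<dots> \<le> sqrt D * (sqrt B * norm x)"
    using D by (intro mult_left_mono W(1)) simp
  finally show "norm (?U x) \<le> sqrt D * sqrt B * norm x" by (simp add: ac_simps)
qed

text \<open>This is the factorization of the cross-Gram operator as the adjoint of
  \<open>synth s\<close> after \<open>synth w\<close>, in weak form.\<close>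

lemma cinner_cross_gram:
  fixes s w :: "nat \<Rightarrow> 'a::chilbert_space"
  assumes w: "riesz_basis W w A B" and s: "riesz_basis S s C D"
  shows "cinner y (matrix_op (\<lambda>i j. cinner (s i) (w j)) x) = cinner (synth s y) (synth w x)"
proof -
  have "(\<lambda>k. cnj (cinner (synth w x) (s k) * coord y k)) sums cnj (cinner (synth w x) (synth s y))"
    unfolding sums_cnj by (rule cinner_synth_sums[OF s])
  moreover have "cnj (cinner (synth w x) (s k) * coord y k)
      = cnj (coord y k) * coord (matrix_op (\<lambda>i j. cinner (s i) (w j)) x) k" for k
    unfolding coord_cross_gram[OF w s]
    by (metis cinner_commute complex_cnj_mult mult.commute)
  moreover have "cnj (cinner (synth w x) (synth s y)) = cinner (synth s y) (synth w x)"
    by (metis cinner_commute)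
  ultimately have "(\<lambda>k. cnj (coord y k) * coord (matrix_op (\<lambda>i j. cinner (s i) (w j)) x) k)
      sums cinner (synth s y) (synth w x)" by (simp only:)
  then show ?thesis by (simp add: sums_iff cinner_l2.rep_eq)
qed

text \<open>\<open>cadjoint\<close> is a \<open>SOME\<close> choice; any two candidates agree,
  because their difference at \<open>y\<close> is orthogonal to every vector, itself
  included.\<close>

lemma cadjoint_eq:
  assumes "\<And>x y. cinner (T x) y = cinner x (R y)"
  shows "cadjoint T = R"
proof -
  have "\<forall>x y. cinner (T x) y = cinner x (cadjoint T y)"
    unfolding cadjoint_def by (rule someI[of _ R]) (use assms in blast)
  then have "cinner (cadjoint T y - R y) (cadjoint T y - R y) = 0" for y
    unfolding cinner_diff_right by (metis assms cinner_diff_right right_minus_eq)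
  then show ?thesis by (auto simp: cinner_same_eq_zero)
qed

text \<open>Both matrices represent the form \<open>(x, y) \<mapsto> \<langle>synth w x, synth s y\<rangle>\<close>, so no representation
  theorem is needed for the existence of the adjoint.\<close>

lemma cadjoint_cross_gram:
  fixes s w :: "nat \<Rightarrow> 'a::chilbert_space"
  assumes w: "riesz_basis W w A B" and s: "riesz_basis S s C D"
  shows "cadjoint (matrix_op (\<lambda>i j. cinner (s i) (w j))) = matrix_op (\<lambda>i j. cinner (w i) (s j))"
  by (rule cadjoint_eq) (metis cinner_commute cinner_cross_gram[OF w s] cinner_cross_gram[OF s w])

text \<open>The vectors orthogonal to \<open>synth w x\<close> form a closed subspace containing
  every \<open>s i\<close>, hence the closure of their span, which is \<open>S\<close>.\<close>

lemma synth_in_orth_compl: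
  fixes s w :: "nat \<Rightarrow> 'a::chilbert_space"
  assumes w: "riesz_basis W w A B" and s: "riesz_basis S s C D"
    and 0: "matrix_op (\<lambda>i j. cinner (s i) (w j)) x = 0"
  shows "synth w x \<in> orth_compl S"
proof -
  let ?g = "synth w x"
  let ?Z = "{y. cinner ?g y = 0}"
  have s0: "cinner (s i) ?g = 0" for i
    using coord_cross_gram[OF w s, of x i] by (simp add: 0)
  have "closure (cspan (range s)) \<subseteq> ?Z"
  proof (rule closure_minimal)
    show "cspan (range s) \<subseteq> ?Z"
    proof (rule complex_vector.span_minimal)
      show "range s \<subseteq> ?Z" using s0 cinner_commute[of ?g] by auto
      show "csubspace ?Z"
        by (simp add: complex_vector.subspace_def cinner_add_right cinner_scaleC_right)
    qed
    show "closed ?Z"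
      by (intro closed_Collect_eq linear_continuous_on bounded_linear_cinner_right continuous_on_const)
  qed
  then have "cinner ?g y = 0" if "y \<in> S" for y
    using s that by (auto simp: riesz_basis_def)
  then show ?thesis unfolding orth_compl_def using cinner_commute[of _ ?g] by simp
qed

section \<open>Finite sections\<close>

lemma section_op_eq: "x \<in> range (Proj n) \<Longrightarrow> section_op U n m x = Proj n (cadjoint U (Proj m (U x)))"
  by (simp add: section_op_def in_range_Proj_iff)

lemma range_section_op: "section_op U n m x \<in> range (Proj n)"
  by (simp add: section_op_def)

lemma bounded_clinear_section_op:
  assumes "bounded_clinear U" "bounded_clinear (cadjoint U)"
  shows "bounded_clinear (section_op U n m)"
  unfolding section_op_def by (intro bounded_clinear_compose bounded_clinear_Proj assms)

text \<open>This trades the section for the condition \<open>Proj m (U x) = 0\<close>, which visibly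
  becomes stronger as \<open>m\<close> grows.\<close>

lemma section_op_eq_zero_iff:
  assumes adj: "\<And>x y. cinner (U x) y = cinner x (cadjoint U y)"
    and U: "bounded_clinear (cadjoint U)"
    and x: "x \<in> range (Proj n)"
  shows "section_op U n m x = 0 \<longleftrightarrow> Proj m (U x) = 0"
proof
  assume "section_op U n m x = 0"
  then have "0 = cinner x (Proj n (cadjoint U (Proj m (U x))))" by (simp add: section_op_eq x)
  also have "\<dots> = cinner (U x) (Proj m (U x))"
    using x by (simp add: cinner_Proj[where n = n, symmetric] in_range_Proj_iff adj[symmetric])
  also have "\<dots> = cinner (Proj m (U x)) (Proj m (U x))" by (simp add: cinner_Proj)
  finally show "Proj m (U x) = 0" by (simp add: cinner_same_eq_zero)
next
  assume "Proj m (U x) = 0"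
  then show "section_op U n m x = 0"
    by (simp add: section_op_eq x bounded_clinear_zero[OF U] bounded_clinear_zero[OF bounded_clinear_Proj])
qed

text \<open>On the range of \<open>Proj n\<close> the injective \<open>U\<close> is bounded below,
  and the truncations of \<open>U\<close> converge to it uniformly on bounded sets, since they
  converge on the \<open>n\<close> unit vectors. A nonzero \<open>x\<close> with
  \<open>Proj m (U x) = 0\<close> would violate the lower bound once \<open>m\<close> is
  large.\<close>

lemma ex_section_injective:
  assumes adj: "\<And>x y. cinner (U x) y = cinner x (cadjoint U y)"
    and U: "bounded_clinear U" "bounded_clinear (cadjoint U)"
    and inj: "\<And>x. U x = 0 \<Longrightarrow> x = 0"
  shows "\<exists>m\<ge>1. \<forall>x\<in>range (Proj n). Proj m (U x) = 0 \<longrightarrow> x = 0"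
proof -
  let ?V = "range (Proj n)"
  \<comment> \<open>The quadratic form of \<open>G\<close> on \<open>?V\<close> is the squared norm
    of \<open>U x\<close>, so \<open>G\<close> is injective there; its bounded inverse supplies the
    lower bound for \<open>U\<close>.\<close>
  define G where "G = Proj n \<circ> cadjoint U \<circ> U"
  have G: "bounded_clinear G"
    unfolding G_def by (intro bounded_clinear_compose bounded_clinear_Proj U)
  have bij: "bij_betw G ?V ?V"
  proof (rule bij_betw_range_Proj[OF G])
    fix x assume x: "x \<in> ?V" "G x = 0"
    have "cinner (U x) (U x) = cinner x (G x)"
      using x(1) by (simp add: G_def adj cinner_Proj[symmetric] in_range_Proj_iff)
    then show "x = 0" using x(2) inj by (simp add: cinner_same_eq_zero)
  qed (auto simp: G_def)
  obtain K where K: "\<And>x. x \<in> ?V \<Longrightarrow> norm (inv_into ?V G x) \<le> K * norm x"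
    using bounded_op_on_inv_into[OF G bij] unfolding bounded_op_on_def by blast
  have invG: "inv_into ?V G (G x) = x" "G x \<in> ?V" if "x \<in> ?V" for x
    using that bij by (auto simp: bij_betw_def inv_into_f_f)
  obtain L where L: "\<And>x. norm (Proj n (cadjoint U x)) \<le> L * norm x"
    using bounded_clinear_compose[OF bounded_clinear_Proj U(2), of n]
    by (auto simp: bounded_clinear_def)
  \<comment> \<open>This is the constant of \<open>norm_image_range_Proj_le\<close> for the map
    sending \<open>x\<close> to \<open>U x - Proj m (U x)\<close>.\<close>
  define c where "c m = (\<Sum>k<n. norm (U (unit_seq k) - Proj m (U (unit_seq k))))" for m
  have "c \<longlonglongrightarrow> (\<Sum>k<n. norm (U (unit_seq k) - U (unit_seq k)))"
    unfolding c_def by (intro tendsto_intros tendsto_Proj)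
  then have "(\<lambda>m. \<bar>K\<bar> * (\<bar>L\<bar> * c m)) \<longlonglongrightarrow> \<bar>K\<bar> * (\<bar>L\<bar> * 0)"
    by (intro tendsto_intros) simp
  then have "eventually (\<lambda>m. \<bar>K\<bar> * (\<bar>L\<bar> * c m) < 1 \<and> 1 \<le> m) sequentially"
    by (intro eventually_conj order_tendstoD(2) eventually_ge_at_top) auto
  then obtain m where m: "\<bar>K\<bar> * (\<bar>L\<bar> * c m) < 1" "1 \<le> m"
    using eventually_happens'[OF sequentially_bot] by blast
  have "x = 0" if x: "x \<in> ?V" "Proj m (U x) = 0" for x
  proof (rule ccontr)
    assume "x \<noteq> 0"
    have "norm (U x - Proj m (U x)) \<le> c m * norm x"
      unfolding c_def
      by (rule norm_image_range_Proj_le[OF _ _ x(1)])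
        (simp_all add: bounded_clinear_add[OF U(1)] bounded_clinear_scaleC[OF U(1)] Proj_add
          Proj_scaleC complex_vector.scale_right_diff_distrib)
    then have Ux: "norm (U x) \<le> c m * norm x" by (simp add: x(2))
    have "norm (G x) \<le> L * norm (U x)" using L by (simp add: G_def)
    also have "\<dots> \<le> \<bar>L\<bar> * norm (U x)" by (simp add: mult_right_mono)
    also have "\<dots> \<le> \<bar>L\<bar> * (c m * norm x)" by (simp add: mult_left_mono Ux)
    finally have Gx: "norm (G x) \<le> \<bar>L\<bar> * (c m * norm x)" .
    have "norm x = norm (inv_into ?V G (G x))" by (simp add: invG x(1))
    also have "\<dots> \<le> K * norm (G x)" by (intro K invG x(1))
    also have "\<dots> \<le> \<bar>K\<bar> * norm (G x)" by (simp add: mult_right_mono)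
    also have "\<dots> \<le> \<bar>K\<bar> * (\<bar>L\<bar> * (c m * norm x))" by (simp add: mult_left_mono Gx)
    also have "\<dots> = (\<bar>K\<bar> * (\<bar>L\<bar> * c m)) * norm x" by simp
    also have "\<dots> < 1 * norm x" using m(1) \<open>x \<noteq> 0\<close> by (intro mult_strict_right_mono) auto
    finally show False by simp
  qed
  then show ?thesis using m(2) by blast
qed

text \<open>Apply the inverse section to the equation with \<open>Proj n \<beta>\<close> subtracted:
  the coefficient error within the first \<open>n\<close> coordinates is the operator of
  \<open>K_const\<close> applied to \<open>Proj_perp n \<beta>\<close>. The omitted coefficients
  contribute the summand 1.\<close>

lemma section_solution_error:
  fixes w :: "nat \<Rightarrow> 'h::chilbert_space"
  assumes w: "riesz_basis W w A B"
    and U: "bounded_clinear U" "bounded_clinear (cadjoint U)"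
    and bij: "bij_betw (section_op U n m) (range (Proj n)) (range (Proj n))"
    and \<beta>': "\<beta>' \<in> range (Proj n)"
    and sol: "section_op U n m \<beta>' = Proj n (cadjoint U (Proj m (U \<beta>)))"
  shows "norm (synth w \<beta> - synth w \<beta>') \<le> sqrt B * (1 + K_const U n m) * norm (Proj_perp n \<beta>)"
proof -
  let ?V = "range (Proj n)"
  let ?T = "section_op U n m"
  let ?R = "inv_into ?V ?T"
  \<comment> \<open>The right-nested form is the one \<open>comp_assoc\<close> gives to
    \<open>K_const\<close>.\<close>
  let ?E = "Proj n \<circ> (cadjoint U \<circ> (Proj m \<circ> (U \<circ> Proj_perp n)))"
  let ?p = "Proj_perp n \<beta>"
  have T: "bounded_clinear ?T" by (rule bounded_clinear_section_op[OF U])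
  have E: "bounded_clinear ?E"
    by (intro bounded_clinear_compose bounded_clinear_Proj bounded_clinear_Proj_perp U)
  have "bounded_linear (?R \<circ> ?E)"
    by (rule bounded_linear_compose_bounded_op_on[OF bounded_op_on_inv_into[OF T bij] E]) auto
  then have "norm ((?R \<circ> ?E) ?p) \<le> K_const U n m * norm ?p"
    unfolding K_const_def comp_assoc by (rule onorm)
  moreover have "(?R \<circ> ?E) ?p = \<beta>' - Proj n \<beta>"
  proof -
    \<comment> \<open>Splitting \<open>?p\<close> as \<open>\<beta> - Proj n \<beta>\<close> gives
      the right-hand side of \<open>sol\<close> minus the section at
      \<open>Proj n \<beta>\<close>.\<close>
    have "?E ?p = ?T \<beta>' - ?T (Proj n \<beta>)"
      by (simp add: sol section_op_eq Proj_perp_def Proj_diff bounded_clinear_diff[OF U(1)]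
          bounded_clinear_diff[OF U(2)])
    then have "?E ?p = ?T (\<beta>' - Proj n \<beta>)" by (simp add: bounded_clinear_diff[OF T])
    moreover have "\<beta>' - Proj n \<beta> \<in> ?V" using \<beta>' by (simp add: in_range_Proj_iff Proj_diff)
    ultimately show ?thesis using bij by (simp add: bij_betw_def inv_into_f_f)
  qed
  ultimately have *: "norm (\<beta>' - Proj n \<beta>) \<le> K_const U n m * norm ?p" by simp
  have "norm (synth w \<beta> - synth w \<beta>') = norm (synth w (?p - (\<beta>' - Proj n \<beta>)))"
    unfolding bounded_clinear_diff[OF bounded_clinear_synth(2)[OF w], symmetric] Proj_perp_def by simp
  also have "\<dots> \<le> sqrt B * norm (?p - (\<beta>' - Proj n \<beta>))"
    by (rule bounded_clinear_synth(1)[OF w])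
  also have "\<dots> \<le> sqrt B * (norm ?p + K_const U n m * norm ?p)"
    using w * norm_triangle_ineq4[of ?p "\<beta>' - Proj n \<beta>"]
    by (intro mult_left_mono) (auto simp: riesz_basis_def)
  finally show ?thesis by (simp add: algebra_simps)
qed

theorem theorem4p1:
  fixes S W :: "'h::chilbert_space set"
    and s w :: "nat \<Rightarrow> 'h"
    and A B C D :: real
    and U :: "l2 \<Rightarrow> l2"
    and \<beta> :: l2
    and f :: 'h
    and n :: nat
  assumes separable: "separable_space (euclidean :: 'h topology)"
    and S: "csubspace S" "closed S"
    and W: "csubspace W" "closed W"
    and WS: "W \<inter> orth_compl S = {0}"
    and w: "riesz_basis W w A B"
    and s: "riesz_basis S s C D"
    and U: "U = matrix_op (\<lambda>i j. cinner (s i) (w j))"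
    and f: "f = (\<Sum>k. coord \<beta> k *\<^sub>C w k)"
    and n: "1 \<le> n"
  shows "let good = {k. 1 \<le> k \<and> 0 \<notin> spectrum_on (range (Proj n)) (section_op U n k)} in
    \<exists>M. M \<in> good \<and> (\<forall>k\<in>good. M \<le> k) \<and>
    (\<forall>m\<ge>M.
       let rhs = (Proj n \<circ> cadjoint U \<circ> Proj m) (fin_l2 m (\<lambda>i. cinner (s i) f))
       in (\<exists>!\<beta>'. \<beta>' \<in> range (Proj n) \<and> section_op U n m \<beta>' = rhs) \<and>
          (\<forall>\<beta>'. \<beta>' \<in> range (Proj n) \<and> section_op U n m \<beta>' = rhs \<longrightarrow>
             norm (f - (\<Sum>k<n. coord \<beta>' k *\<^sub>C w k))
               \<le> sqrt B * (1 + K_const U n m) * norm (Proj_perp n \<beta>)))"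
proof -
  let ?V = "range (Proj n)"
  let ?T = "section_op U n"
  define good where "good = {k. 1 \<le> k \<and> 0 \<notin> spectrum_on ?V (?T k)}"
  have adjU: "cadjoint U = matrix_op (\<lambda>i j. cinner (w i) (s j))"
    unfolding U by (rule cadjoint_cross_gram[OF w s])
  have bU: "bounded_clinear U" "bounded_clinear (cadjoint U)"
    unfolding adjU unfolding U
    by (rule bounded_clinear_cross_gram[OF w s] bounded_clinear_cross_gram[OF s w])+
  have adj: "cinner (U x) y = cinner x (cadjoint U y)" for x y
    unfolding adjU unfolding U
    by (metis cinner_commute cinner_cross_gram[OF w s] cinner_cross_gram[OF s w])
  have injU: "x = 0" if "U x = 0" for x
  proof -
    have "synth w x \<in> W \<inter> orth_compl S"
      using synth_in[OF w] synth_in_orth_compl[OF w s] that unfolding U by blast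
    then show ?thesis using WS synth_eq_zero[OF w] by blast
  qed
  have bT: "bounded_clinear (?T k)" for k by (rule bounded_clinear_section_op[OF bU])
  have TV: "?T k ` ?V \<subseteq> ?V" for k by (auto simp: range_section_op)
  have good_iff: "k \<in> good \<longleftrightarrow> 1 \<le> k \<and> (\<forall>x\<in>?V. Proj k (U x) = 0 \<longrightarrow> x = 0)" for k
    unfolding good_def mem_Collect_eq zero_notin_spectrum_on_range_Proj_iff[OF bT TV]
    using section_op_eq_zero_iff[OF adj bU(2)] by blast
  define M where "M = (LEAST k. k \<in> good)"
  have "\<exists>k. k \<in> good"
    using ex_section_injective[OF adj bU injU, of n] by (auto simp: good_iff)
  then have M: "M \<in> good" unfolding M_def by (rule LeastI_ex)
  \<comment> \<open>Truncating at \<open>m\<close> and then at \<open>M \<le> m\<close> is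
    truncating at \<open>M\<close>, so the kernel on \<open>?V\<close> can only shrink and goodness
    persists above the least good index.\<close>
  have good_up: "m \<in> good" if "M \<le> m" for m
  proof -
    have "Proj M (U x) = 0" if "Proj m (U x) = 0" for x
    proof -
      have "Proj M (U x) = Proj M (Proj m (U x))"
        using \<open>M \<le> m\<close> by (intro coord_eqI) simp
      then show ?thesis using that by (simp add: bounded_clinear_zero[OF bounded_clinear_Proj])
    qed
    then show ?thesis using M that unfolding good_iff by (metis order_trans)
  qed
  have main: "(\<exists>!\<beta>'. \<beta>' \<in> ?V \<and> ?T m \<beta>' = rhs) \<and>
      (\<forall>\<beta>'. \<beta>' \<in> ?V \<and> ?T m \<beta>' = rhs \<longrightarrow>
         norm (f - (\<Sum>k<n. coord \<beta>' k *\<^sub>C w k)) \<le> sqrt B * (1 + K_const U n m) * norm (Proj_perp n \<beta>))"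
    if m: "M \<le> m" and rhs: "rhs = (Proj n \<circ> cadjoint U \<circ> Proj m) (fin_l2 m (\<lambda>i. cinner (s i) f))"
    for m rhs
  proof -
    have bij: "bij_betw (?T m) ?V ?V"
      using good_up[OF m] section_op_eq_zero_iff[OF adj bU(2)]
      by (intro bij_betw_range_Proj bT TV) (auto simp: good_iff)
    \<comment> \<open>The samples \<open>cinner (s i) f\<close> for \<open>i < m\<close> are the
      first \<open>m\<close> coordinates of \<open>U \<beta>\<close>, which brings the system into
      the form \<open>sol\<close> of \<open>section_solution_error\<close>.\<close>
    have "Proj m (fin_l2 m (\<lambda>i. cinner (s i) f)) = Proj m (U \<beta>)"
      unfolding f U synth_def[symmetric] by (rule coord_eqI) (simp add: coord_cross_gram[OF w s])
    then have rhs': "rhs = Proj n (cadjoint U (Proj m (U \<beta>)))" by (simp add: rhs)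
    have "\<exists>!\<beta>'. \<beta>' \<in> ?V \<and> ?T m \<beta>' = rhs"
    proof (rule ex_ex1I)
      have "rhs \<in> ?T m ` ?V" unfolding bij_betw_imp_surj_on[OF bij] rhs' by (rule rangeI)
      then show "\<exists>\<beta>'. \<beta>' \<in> ?V \<and> ?T m \<beta>' = rhs" by auto
    qed (use bij_betw_imp_inj_on[OF bij] in \<open>auto dest: inj_onD\<close>)
    moreover have "norm (f - (\<Sum>k<n. coord \<beta>' k *\<^sub>C w k)) \<le> sqrt B * (1 + K_const U n m) * norm (Proj_perp n \<beta>)"
      if "\<beta>' \<in> ?V" "?T m \<beta>' = rhs" for \<beta>'
    proof -
      \<comment> \<open>All coordinates of \<open>\<beta>'\<close> from \<open>n\<close> on vanish,
        so the synthesis series is this finite sum.\<close>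
      have "(\<Sum>k<n. coord \<beta>' k *\<^sub>C w k) = synth w \<beta>'"
        using that(1) synth_Proj[of w n \<beta>'] by (simp add: in_range_Proj_iff)
      then show ?thesis
        using section_solution_error[OF w bU bij that(1)] that(2) by (simp add: f synth_def rhs')
    qed
    ultimately show ?thesis by blast
  qed
  show ?thesis
    unfolding Let_def good_def[symmetric]
  proof (intro exI conjI allI impI ballI)
    show "M \<le> k" if "k \<in> good" for k unfolding M_def by (rule Least_le[of "\<lambda>k. k \<in> good", OF that])
  qed (use M main in blast)+
qed

end
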